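(* Let $G_1$ be a connected $\delta_1$-regular graph on $n$ vertices and $G_2$ a connected $\delta_2$-regular graph on $\delta_1$ vertices, with $\delta_1\geqslant 4$, and let $G_1\circledR G_2$ be their replacement product (with respect to an arbitrary edge labelling of $G_1$). Write $\kappa_i=\kappa(G_i)$, $\lambda_i=\lambda(G_i)$ for $i=1,2$ and $\lambda_2'=\lambda'(G_2)$. Then $$\min\{\lambda_1,\;\kappa_1+\lambda_2-1,\;2\lambda_2,\;\lambda_2'+2\}\leqslant \lambda'(G_1\circledR G_2)\leqslant\min\{\lambda_1,2\delta_2\}.$$ Furthermore, if $\kappa_1\geqslant \lambda_1-\lambda_2+1$ or $\kappa_1\geqslant \lambda_2+1$, and $G_2$ is $\lambda'$-optimal, then $$\lambda'(G_1\circledR G_2)=\min\{\lambda_1,2\delta_2\}.$$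
   Context: All graphs are finite, simple and undirected. $\kappa(G)$ and $\lambda(G)$ denote the (vertex-)connectivity and edge-connectivity of $G$ (with the usual convention $\kappa(K_m)=m-1$). Restricted edge-connectivity: for a non-trivial connected graph $G$, a set $F\subset E(G)$ is a restricted edge-cut if $G-F$ is disconnected and contains no isolated vertices; $\lambda'(G)$ is the minimum cardinality of a restricted edge-cut of $G$. It is well-defined for every connected graph of order at least $4$ other than a star $K_{1,m}$; $G$ is called $\lambda'$-connected if $\lambda'(G)$ exists. Let $\xi(G)=\min\{d_G(x)+d_G(y)-2: xy\in E(G)\}$ be the minimum edge-degree. A $\lambda'$-connected graph $G$ is $\lambda'$-optimal if $\lambda'(G)=\xi(G)$. Replacement product: let $G_1$ be a $\delta_1$-regular graph on $n$ vertices and $G_2$ a $\delta_2$-regular graph on $\delta_1$ vertices. For every vertex $x\in V(G_1)$, label the $\delta_1$ edges incident with $x$ bijectively by the vertices of $G_2$; $e_x^i$ denotes the edge at $x$ with label $i\in V(G_2)$ (an edge $xy$ may receive different labels at $x$ and at $y$). The replacement product $G_1\circledR G_2$ has vertex-set $V(G_1)\times V(G_2)$; two distinct vertices $(x,i)$ and $(y,j)$ are adjacent if and only if either $x=y$ and $ij\in E(G_2)$, or $xy\in E(G_1)$ and $e_x^i=xy=e_y^j$. *)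

theory Defs
  imports Main
begin

section \<open>Finite simple undirected graphs\<close>

record 'a ugraph =
  verts :: "'a set"
  edges :: "'a set set"

definition simple_graph :: "'a ugraph \<Rightarrow> bool" where
  "simple_graph G \<longleftrightarrow> finite (verts G) \<and>
     (\<forall>e \<in> edges G. \<exists>x \<in> verts G. \<exists>y \<in> verts G. x \<noteq> y \<and> e = {x, y})"

definition incident_edges :: "'a ugraph \<Rightarrow> 'a \<Rightarrow> 'a set set" where
  "incident_edges G x = {e \<in> edges G. x \<in> e}"

definition degree :: "'a ugraph \<Rightarrow> 'a \<Rightarrow> nat" where
  "degree G x = card (incident_edges G x)"

definition regular_graph :: "nat \<Rightarrow> 'a ugraph \<Rightarrow> bool" where
  "regular_graph d G \<longleftrightarrow> (\<forall>x \<in> verts G. degree G x = d)"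

definition complete_graph :: "'a ugraph \<Rightarrow> bool" where
  "complete_graph G \<longleftrightarrow> (\<forall>x \<in> verts G. \<forall>y \<in> verts G. x \<noteq> y \<longrightarrow> {x, y} \<in> edges G)"

definition adj_rel :: "'a ugraph \<Rightarrow> ('a \<times> 'a) set" where
  "adj_rel G = {(x, y). {x, y} \<in> edges G}"

definition connected_graph :: "'a ugraph \<Rightarrow> bool" where
  "connected_graph G \<longleftrightarrow> verts G \<noteq> {} \<and>
     (\<forall>x \<in> verts G. \<forall>y \<in> verts G. (x, y) \<in> (adj_rel G)\<^sup>*)"

definition delete_verts :: "'a ugraph \<Rightarrow> 'a set \<Rightarrow> 'a ugraph" where
  "delete_verts G S = \<lparr>verts = verts G - S, edges = {e \<in> edges G. e \<inter> S = {}}\<rparr>"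

definition delete_edges :: "'a ugraph \<Rightarrow> 'a set set \<Rightarrow> 'a ugraph" where
  "delete_edges G F = \<lparr>verts = verts G, edges = edges G - F\<rparr>"


section \<open>Connectivity and edge-connectivity\<close>

text \<open>
  Minima are written as infima in \<open>nat\<close>, which are attained for nonempty sets; \<open>Inf {}\<close> is
  unspecified there. A non-complete graph has a vertex cut, and a graph with at least two
  vertices has an edge cut; for the remaining graphs the edge-connectivity is set to \<open>0\<close>.
\<close>

text \<open>The subset is proper so that the empty graph does not count as a disconnected \<open>G - S\<close>.\<close>

definition vertex_cut :: "'a ugraph \<Rightarrow> 'a set \<Rightarrow> bool" where
  "vertex_cut G S \<longleftrightarrow> S \<subset> verts G \<and> \<not> connected_graph (delete_verts G S)"

definition vertex_connectivity :: "'a ugraph \<Rightarrow> nat" where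
  "vertex_connectivity G =
     (if complete_graph G then card (verts G) - 1
      else (INF S \<in> {S. vertex_cut G S}. card S))"

definition edge_cut :: "'a ugraph \<Rightarrow> 'a set set \<Rightarrow> bool" where
  "edge_cut G F \<longleftrightarrow> F \<subseteq> edges G \<and> \<not> connected_graph (delete_edges G F)"

definition edge_connectivity :: "'a ugraph \<Rightarrow> nat" where
  "edge_connectivity G =
     (if \<exists>F. edge_cut G F then (INF F \<in> {F. edge_cut G F}. card F) else 0)"


section \<open>Restricted edge-connectivity\<close>

definition restricted_edge_cut :: "'a ugraph \<Rightarrow> 'a set set \<Rightarrow> bool" where
  "restricted_edge_cut G F \<longleftrightarrow> F \<subseteq> edges G \<and> \<not> connected_graph (delete_edges G F) \<and>
     (\<forall>x \<in> verts G. degree (delete_edges G F) x \<noteq> 0)"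

text \<open>
  For a connected finite \<open>G\<close> the empty set is not a restricted edge-cut, so the
  value \<open>0\<close> occurs exactly when there is no restricted edge-cut, i.e. when \<open>\<lambda>'(G)\<close> does not
  exist; a positive lower bound therefore includes the existence of \<open>\<lambda>'(G)\<close>.
\<close>

definition restricted_edge_connectivity :: "'a ugraph \<Rightarrow> nat" where
  "restricted_edge_connectivity G =
     (if \<exists>F. restricted_edge_cut G F then (INF F \<in> {F. restricted_edge_cut G F}. card F)
      else 0)"

definition restricted_connected :: "'a ugraph \<Rightarrow> bool" where
  "restricted_connected G \<longleftrightarrow> 2 \<le> card (verts G) \<and> connected_graph G \<and>
     (\<exists>F. restricted_edge_cut G F)"

text \<open>For simple graphs the subtraction does not truncate: both ends of an edge have positive degree.\<close>

definition min_edge_degree :: "'a ugraph \<Rightarrow> nat" where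
  "min_edge_degree G =
     (INF (x, y) \<in> {(x, y). {x, y} \<in> edges G}. degree G x + degree G y - 2)"

definition restricted_optimal :: "'a ugraph \<Rightarrow> bool" where
  "restricted_optimal G \<longleftrightarrow> restricted_connected G \<and>
     restricted_edge_connectivity G = min_edge_degree G"


section \<open>Replacement product\<close>

text \<open>
  An edge labelling is given by the map \<open>e\<close> for which \<open>e x i\<close> is the edge \<open>e\<^sub>x\<^sup>i\<close>, that is, the
  edge at \<open>x\<close> with label \<open>i\<close>. The labels of an edge at its two ends are unrelated.
\<close>

definition edge_labelling ::
    "'a ugraph \<Rightarrow> 'b ugraph \<Rightarrow> ('a \<Rightarrow> 'b \<Rightarrow> 'a set) \<Rightarrow> bool" where
  "edge_labelling G\<^sub>1 G\<^sub>2 e \<longleftrightarrow>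
     (\<forall>x \<in> verts G\<^sub>1. bij_betw (e x) (verts G\<^sub>2) (incident_edges G\<^sub>1 x))"

definition replacement_product ::
    "'a ugraph \<Rightarrow> 'b ugraph \<Rightarrow> ('a \<Rightarrow> 'b \<Rightarrow> 'a set) \<Rightarrow> ('a \<times> 'b) ugraph" where
  "replacement_product G\<^sub>1 G\<^sub>2 e =
     \<lparr>verts = verts G\<^sub>1 \<times> verts G\<^sub>2,
      edges = {{(x, i), (y, j)} | x i y j.
        x \<in> verts G\<^sub>1 \<and> i \<in> verts G\<^sub>2 \<and> y \<in> verts G\<^sub>1 \<and> j \<in> verts G\<^sub>2 \<and> (x, i) \<noteq> (y, j) \<and>
        (x = y \<and> {i, j} \<in> edges G\<^sub>2 \<or>
         {x, y} \<in> edges G\<^sub>1 \<and> e x i = {x, y} \<and> e y j = {x, y})}\<rparr>"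

end

theory Submission
  imports Defs
begin

text \<open>
  Every cut can be replaced by the edge boundary of a vertex set \<open>X\<close>, and a restricted cut by the
  boundary of an \<open>X\<close> for which every vertex has a neighbour on its own side of \<open>X\<close>
  (\<open>restricted_edge_cut_contains_boundary\<close>). So the theorem is about the sizes of such boundaries in
  the product. The edges of the product are of two kinds, those inside a fibre \<open>{x} \<times> V(G\<^sub>2)\<close>, which
  is a copy of \<open>G\<^sub>2\<close>, and one cross edge for each edge of \<open>G\<^sub>1\<close>. Hence the boundary of \<open>X\<close> has as
  many edges as the boundaries cut out in the fibres have together, plus the number of edges of
  \<open>G\<^sub>1\<close> whose cross edge leaves \<open>X\<close> (\<open>card_boundary_R\<close>). All bounds are read off this formula.

  For the upper bounds, take \<open>X = P \<times> V(G\<^sub>2)\<close>, where \<open>P\<close> is one side of a minimum edge cut of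
  \<open>G\<^sub>1\<close>, and \<open>X = {x} \<times> {i, j}\<close>, where \<open>ij\<close> is an edge of \<open>G\<^sub>2\<close>.

  For the lower bound, call a fibre mixed if it meets both \<open>X\<close> and its complement. A mixed fibre
  contributes at least \<open>\<lambda>\<^sub>2\<close>, so two of them give \<open>2\<lambda>\<^sub>2\<close>. Without mixed fibres, \<open>X\<close> is a union of
  fibres and gives an edge cut of \<open>G\<^sub>1\<close>. Let \<open>x\<close> carry the only mixed fibre, and let \<open>P\<close> and \<open>Q\<close> be
  the sets of vertices of \<open>G\<^sub>1\<close> whose fibre is inside and outside \<open>X\<close>. If both are nonempty, at
  least \<open>\<kappa>\<^sub>1 - 1\<close> edges join them, by the argument for \<open>\<kappa> \<le> \<lambda>\<close> in \<open>G\<^sub>1 - x\<close>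
  (\<open>vertex_connectivity_le_crossing_edges\<close>). Otherwise \<open>X\<close> or its complement is \<open>{x} \<times> B\<close>, and all
  cross edges at this set leave it; these are \<open>|B| \<ge> 2\<close> edges, which makes up the term
  \<open>\<lambda>'\<^sub>2 + 2\<close> (\<open>card_boundary_within_fibre\<close>).

  If \<open>G\<^sub>2\<close> is \<open>\<lambda>'\<close>-optimal, then \<open>\<lambda>'\<^sub>2 + 2 = 2\<delta>\<^sub>2\<close>, and also \<open>\<lambda>\<^sub>2 \<ge> \<delta>\<^sub>2\<close>
  (\<open>restricted_optimal_regular\<close>). With either condition on \<open>\<kappa>\<^sub>1\<close>, each of the four terms of the
  lower bound is then at least \<open>\<lambda>\<^sub>1\<close> or at least \<open>2\<delta>\<^sub>2\<close>.
\<close>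

section \<open>Edge boundaries and cuts\<close>

definition boundary :: "'a ugraph \<Rightarrow> 'a set \<Rightarrow> 'a set set" where
  "boundary G X = {f \<in> edges G. f \<inter> X \<noteq> {} \<and> \<not> f \<subseteq> X}"

text \<open>
  These are the sets whose boundary isolates no vertex when it is removed.
\<close>

definition restricted_side :: "'a ugraph \<Rightarrow> 'a set \<Rightarrow> bool" where
  "restricted_side G X \<longleftrightarrow> X \<noteq> {} \<and> X \<subset> verts G \<and>
     (\<forall>v \<in> verts G. \<exists>w. {v, w} \<in> edges G \<and> (w \<in> X \<longleftrightarrow> v \<in> X))"

lemma simple_edge_ends:
  assumes "simple_graph G" "{x, y} \<in> edges G"
  shows "x \<noteq> y" "x \<in> verts G" "y \<in> verts G"
proof -
  obtain a b where "a \<in> verts G" "b \<in> verts G" "a \<noteq> b" "{x, y} = {a, b}"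
    using assms unfolding simple_graph_def by blast
  then show "x \<noteq> y" "x \<in> verts G" "y \<in> verts G" by (auto simp: doubleton_eq_iff)
qed

lemma simple_edgeE:
  assumes "simple_graph G" "f \<in> edges G"
  obtains x y where "x \<in> verts G" "y \<in> verts G" "x \<noteq> y" "f = {x, y}"
  using assms unfolding simple_graph_def by blast

lemma simple_edge_subset:
  assumes "simple_graph G" "f \<in> edges G"
  shows "f \<subseteq> verts G"
proof -
  obtain x y where "x \<in> verts G" "y \<in> verts G" "f = {x, y}"
    by (rule simple_edgeE[OF assms])
  then show ?thesis by simp
qed

lemma finite_edges:
  assumes "simple_graph G"
  shows "finite (edges G)"
proof (rule finite_subset)
  show "edges G \<subseteq> Pow (verts G)"
    using simple_edge_subset[OF assms] by blast
  show "finite (Pow (verts G))"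
    using assms unfolding simple_graph_def by simp
qed

lemma finite_boundary: "simple_graph G \<Longrightarrow> finite (boundary G X)"
  using finite_edges[of G] by (simp add: boundary_def)

lemma boundary_complement:
  assumes "simple_graph G"
  shows "boundary G (verts G - X) = boundary G X"
proof -
  have "f \<subseteq> verts G" if "f \<in> edges G" for f
    using simple_edge_subset[OF assms that] .
  then show ?thesis unfolding boundary_def by blast
qed

lemma restricted_side_complement:
  assumes "simple_graph G" "restricted_side G X"
  shows "restricted_side G (verts G - X)"
proof -
  have X: "X \<noteq> {}" "X \<subset> verts G"
    and nb: "\<forall>v \<in> verts G. \<exists>w. {v, w} \<in> edges G \<and> (w \<in> X \<longleftrightarrow> v \<in> X)"
    using assms(2) unfolding restricted_side_def by blast+
  have "\<exists>w. {v, w} \<in> edges G \<and> (w \<in> verts G - X \<longleftrightarrow> v \<in> verts G - X)"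
    if v: "v \<in> verts G" for v
  proof -
    obtain w where w: "{v, w} \<in> edges G" "w \<in> X \<longleftrightarrow> v \<in> X" using nb v by blast
    then show ?thesis using v simple_edge_ends(3)[OF assms(1) w(1)] by blast
  qed
  then show ?thesis using X unfolding restricted_side_def by blast
qed

lemma delete_edges_empty: "delete_edges G {} = G"
  by (simp add: delete_edges_def)

lemma not_connected_if_closed:
  assumes "u \<in> X" "u \<in> verts G" "v \<in> verts G" "v \<notin> X"
    and closed: "\<And>a b. a \<in> X \<Longrightarrow> {a, b} \<in> edges G \<Longrightarrow> b \<in> X"
  shows "\<not> connected_graph G"
proof
  assume "connected_graph G"
  then have "(u, v) \<in> (adj_rel G)\<^sup>*" using assms unfolding connected_graph_def by blast
  then have "v \<in> X"
    by (induction rule: rtrancl_induct) (use assms in \<open>auto simp: adj_rel_def\<close>)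
  then show False using assms by blast
qed

lemma not_connected_delete_boundary:
  assumes "X \<noteq> {}" "X \<subset> verts G" "boundary G X \<subseteq> F"
  shows "\<not> connected_graph (delete_edges G F)"
proof -
  obtain u v where "u \<in> X" "v \<in> verts G" "v \<notin> X" using assms by blast
  moreover have "b \<in> X" if "a \<in> X" "{a, b} \<in> edges (delete_edges G F)" for a b
  proof -
    have "{a, b} \<in> edges G" "{a, b} \<notin> boundary G X"
      using that(2) assms(3) by (auto simp: delete_edges_def)
    then show ?thesis using that(1) by (simp add: boundary_def)
  qed
  moreover have "u \<in> verts G" using \<open>u \<in> X\<close> assms(2) by blast
  ultimately show ?thesis
    by (intro not_connected_if_closed[of u X _ v]) (simp_all add: delete_edges_def)
qed

text \<open>
  The set \<open>X\<close> is the component of \<open>G - F\<close> that contains a vertex \<open>u\<close> from which not all others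
  can be reached.
\<close>

lemma not_connected_delete_edgesE:
  assumes "simple_graph G" "verts G \<noteq> {}" "\<not> connected_graph (delete_edges G F)"
  obtains X where "X \<noteq> {}" "X \<subset> verts G" "boundary G X \<subseteq> F"
proof -
  let ?R = "(adj_rel (delete_edges G F))\<^sup>*"
  obtain u v where uv: "u \<in> verts G" "v \<in> verts G" "(u, v) \<notin> ?R"
    using assms(2,3) unfolding connected_graph_def by (auto simp: delete_edges_def)
  define X where "X = {w \<in> verts G. (u, w) \<in> ?R}"
  have "f \<in> F" if "f \<in> boundary G X" for f
  proof (rule ccontr)
    assume "f \<notin> F"
    have f: "f \<in> edges G" "f \<inter> X \<noteq> {}" "\<not> f \<subseteq> X" using that by (auto simp: boundary_def)
    obtain p q where pq: "p \<in> verts G" "q \<in> verts G" "f = {p, q}"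
      by (rule simple_edgeE[OF assms(1) f(1)])
    have "p \<in> X \<and> q \<notin> X \<or> q \<in> X \<and> p \<notin> X"
      using f(2,3) pq(3) by auto
    then obtain a b where ab: "f = {a, b}" "a \<in> X" "b \<in> verts G" "b \<notin> X"
      using pq by (metis insert_commute)
    have "(a, b) \<in> adj_rel (delete_edges G F)"
      using ab(1) f(1) \<open>f \<notin> F\<close> by (simp add: adj_rel_def delete_edges_def)
    then have "b \<in> X" using ab(2,3) unfolding X_def by (auto intro: rtrancl_into_rtrancl)
    with ab(4) show False ..
  qed
  moreover have "u \<in> X" "v \<notin> X" "X \<subseteq> verts G" using uv by (auto simp: X_def)
  ultimately show ?thesis using that[of X] uv(2) by blast
qed

lemma delete_edges_degree_nonzero_iff:
  assumes "simple_graph G"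
  shows "degree (delete_edges G F) v \<noteq> 0 \<longleftrightarrow> (\<exists>w. {v, w} \<in> edges G - F)"
proof -
  have "finite (incident_edges (delete_edges G F) v)"
    using finite_edges[OF assms] by (simp add: incident_edges_def delete_edges_def)
  then have "degree (delete_edges G F) v \<noteq> 0 \<longleftrightarrow> (\<exists>f \<in> edges G - F. v \<in> f)"
    by (auto simp: degree_def incident_edges_def delete_edges_def)
  also have "\<dots> \<longleftrightarrow> (\<exists>w. {v, w} \<in> edges G - F)"
  proof
    assume "\<exists>f \<in> edges G - F. v \<in> f"
    then obtain f where f: "f \<in> edges G - F" "v \<in> f" by blast
    with assms obtain x y where "f = {x, y}" by (metis DiffD1 simple_edgeE)
    with f show "\<exists>w. {v, w} \<in> edges G - F" by (auto simp: insert_commute)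
  qed blast
  finally show ?thesis .
qed

lemma edge_connectivity_le_boundary:
  assumes "X \<noteq> {}" "X \<subset> verts G"
  shows "edge_connectivity G \<le> card (boundary G X)"
proof -
  have "edge_cut G (boundary G X)"
    using not_connected_delete_boundary[OF assms order_refl]
    by (auto simp: edge_cut_def boundary_def)
  then show ?thesis
    unfolding edge_connectivity_def by (auto intro!: cINF_lower)
qed

lemma edge_connectivity_attained:
  assumes "simple_graph G" "u \<in> verts G" "v \<in> verts G" "u \<noteq> v"
  obtains X where "X \<noteq> {}" "X \<subset> verts G" "card (boundary G X) = edge_connectivity G"
proof -
  have "{u} \<noteq> {}" "{u} \<subset> verts G" using assms by auto
  from not_connected_delete_boundary[OF this order_refl] have "edge_cut G (boundary G {u})"
    by (auto simp: edge_cut_def boundary_def)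
  then have ex: "\<exists>F. edge_cut G F" by blast
  then have "edge_connectivity G \<in> card ` {F. edge_cut G F}"
    unfolding edge_connectivity_def by (auto intro!: Inf_nat_def1)
  then obtain F where F: "edge_cut G F" "edge_connectivity G = card F" by blast
  then obtain X where X: "X \<noteq> {}" "X \<subset> verts G" "boundary G X \<subseteq> F"
    using assms(1,2) not_connected_delete_edgesE unfolding edge_cut_def by (metis empty_iff)
  have "finite F"
    using F(1) finite_edges[OF assms(1)] finite_subset unfolding edge_cut_def by blast
  then have "card (boundary G X) \<le> edge_connectivity G"
    using X(3) F(2) by (simp add: card_mono)
  then show ?thesis
    using that[OF X(1,2)] edge_connectivity_le_boundary[OF X(1,2)] by simp
qed

lemma restricted_edge_cut_boundary:
  assumes "simple_graph G" "restricted_side G X"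
  shows "restricted_edge_cut G (boundary G X)"
proof -
  have "degree (delete_edges G (boundary G X)) v \<noteq> 0" if "v \<in> verts G" for v
    using assms(2) that unfolding delete_edges_degree_nonzero_iff[OF assms(1)]
    by (auto simp: restricted_side_def boundary_def)
  then show ?thesis
    using assms not_connected_delete_boundary[of X G "boundary G X"]
    by (auto simp: restricted_edge_cut_def restricted_side_def boundary_def)
qed

lemma restricted_edge_connectivity_le_card:
  "restricted_edge_cut G F \<Longrightarrow> restricted_edge_connectivity G \<le> card F"
  unfolding restricted_edge_connectivity_def by (auto intro!: cINF_lower)

lemma restricted_edge_connectivity_attained:
  assumes "restricted_edge_cut G F"
  obtains F' where "restricted_edge_cut G F'" "card F' = restricted_edge_connectivity G"
proof -
  have "restricted_edge_connectivity G \<in> card ` {F. restricted_edge_cut G F}"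
    using assms unfolding restricted_edge_connectivity_def by (auto intro!: Inf_nat_def1)
  then show ?thesis using that by auto
qed

text \<open>
  An edge of \<open>G - F\<close> cannot leave a component of \<open>G - F\<close>, so the neighbour that a vertex keeps
  after the removal of \<open>F\<close> lies on the same side as the vertex itself.
\<close>

lemma restricted_edge_cut_contains_boundary:
  assumes "simple_graph G" "verts G \<noteq> {}" "restricted_edge_cut G F"
  obtains X where "restricted_side G X" "boundary G X \<subseteq> F"
proof -
  obtain X where X: "X \<noteq> {}" "X \<subset> verts G" "boundary G X \<subseteq> F"
    using assms not_connected_delete_edgesE unfolding restricted_edge_cut_def by metis
  have "\<exists>w. {v, w} \<in> edges G \<and> (w \<in> X \<longleftrightarrow> v \<in> X)" if "v \<in> verts G" for v
  proof -
    have "degree (delete_edges G F) v \<noteq> 0"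
      using assms(3) that by (simp add: restricted_edge_cut_def)
    then obtain w where "{v, w} \<in> edges G - F"
      unfolding delete_edges_degree_nonzero_iff[OF assms(1)] by blast
    then show ?thesis using X(3) by (auto simp: boundary_def)
  qed
  then have "restricted_side G X" using X(1,2) unfolding restricted_side_def by blast
  then show ?thesis using that X(3) by blast
qed

lemma edge_connectivity_le_degree:
  assumes "simple_graph G" "v \<in> verts G" "w \<in> verts G" "v \<noteq> w"
  shows "edge_connectivity G \<le> degree G v"
proof -
  have "edge_connectivity G \<le> card (boundary G {v})"
    using assms by (intro edge_connectivity_le_boundary) auto
  also have "\<dots> \<le> degree G v"
    unfolding degree_def
    by (intro card_mono) (auto simp: incident_edges_def boundary_def finite_edges[OF assms(1)])
  finally show ?thesis .
qed

section \<open>Vertex connectivity and edges across a partition\<close>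

lemma vertex_connectivity_le_card:
  assumes "vertex_cut G S" "\<not> complete_graph G"
  shows "vertex_connectivity G \<le> card S"
  using assms unfolding vertex_connectivity_def by (auto intro!: cINF_lower)

lemma vertex_connectivity_le_order:
  assumes "simple_graph G"
  shows "vertex_connectivity G \<le> card (verts G) - 1"
proof (cases "complete_graph G")
  case True
  then show ?thesis by (simp add: vertex_connectivity_def)
next
  case False
  then obtain u v where uv: "u \<in> verts G" "v \<in> verts G" "u \<noteq> v" "{u, v} \<notin> edges G"
    unfolding complete_graph_def by blast
  let ?S = "verts G - {u, v}"
  have "\<not> connected_graph (delete_verts G ?S)"
    using uv simple_edge_ends[OF assms]
    by (intro not_connected_if_closed[of u "{u}" _ v]) (auto simp: delete_verts_def)
  then have "vertex_connectivity G \<le> card ?S"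
    using False uv by (intro vertex_connectivity_le_card) (auto simp: vertex_cut_def)
  also have "\<dots> \<le> card (verts G) - 1"
    using uv by (simp add: card_Diff_subset)
  finally show ?thesis .
qed

text \<open>
  This is Whitney's inequality \<open>\<kappa> \<le> \<lambda>\<close> for \<open>G - x\<close>, with the vertex \<open>x\<close> added to the separating
  set. If some \<open>p \<in> P\<close> and \<open>q \<in> Q\<close> are not adjacent, every edge between \<open>P\<close> and \<open>Q\<close> has an end
  other than \<open>p\<close> and \<open>q\<close>, and these ends together with \<open>x\<close> separate \<open>p\<close> from \<open>q\<close>. Otherwise there
  are \<open>|P||Q| \<ge> |P| + |Q| - 1\<close> such edges, which is the order of \<open>G\<close> minus \<open>2\<close>.
\<close>

lemma vertex_connectivity_le_crossing_edges:
  assumes "simple_graph G" "x \<in> verts G"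
    and PQ: "P \<union> Q = verts G - {x}" "P \<inter> Q = {}" "P \<noteq> {}" "Q \<noteq> {}"
  shows "vertex_connectivity G \<le> card {f \<in> edges G. f \<inter> P \<noteq> {} \<and> f \<inter> Q \<noteq> {}} + 1"
proof -
  define K where "K = {f \<in> edges G. f \<inter> P \<noteq> {} \<and> f \<inter> Q \<noteq> {}}"
  have finV: "finite (verts G)" using assms(1) by (simp add: simple_graph_def)
  have "finite (P \<union> Q)" using PQ(1) finV by simp
  then have fin: "finite P" "finite Q" by auto
  have finK: "finite K" using finite_edges[OF assms(1)] by (simp add: K_def)
  show ?thesis
  proof (cases "\<forall>p \<in> P. \<forall>q \<in> Q. {p, q} \<in> edges G")
    case True
    have "inj_on (\<lambda>(p, q). {p, q}) (P \<times> Q)"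
      using PQ(2) by (auto simp: inj_on_def doubleton_eq_iff)
    then have "card P * card Q = card ((\<lambda>(p, q). {p, q}) ` (P \<times> Q))"
      by (simp add: card_image card_cartesian_product)
    also have "\<dots> \<le> card K"
      using True finK by (intro card_mono) (auto simp: K_def)
    finally have "card P * card Q \<le> card K" .
    moreover have "card P + card Q \<le> card P * card Q + 1"
    proof -
      obtain a b where "card P = Suc a" "card Q = Suc b"
        using fin PQ(3,4) by (metis card_gt_0_iff gr0_implies_Suc)
      then show ?thesis by simp
    qed
    moreover have "card P + card Q = card (verts G) - 1"
      using card_Un_disjoint[OF fin PQ(2)] PQ(1) assms(2) by simp
    ultimately show ?thesis
      using vertex_connectivity_le_order[OF assms(1)] by (simp add: K_def)
  next
    case False
    then obtain p q where pq: "p \<in> P" "q \<in> Q" "{p, q} \<notin> edges G" by blast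
    have "\<exists>v. v \<in> f \<and> v \<noteq> p \<and> v \<noteq> q" if f: "f \<in> K" for f
    proof (rule ccontr)
      assume "\<not> ?thesis"
      then have "f \<subseteq> {p, q}" by blast
      with f PQ(2) pq(1,2) have "f = {p, q}" unfolding K_def by blast
      with f pq(3) show False unfolding K_def by blast
    qed
    then obtain c where c: "\<And>f. f \<in> K \<Longrightarrow> c f \<in> f \<and> c f \<noteq> p \<and> c f \<noteq> q" by metis
    define S where "S = insert x (c ` K)"
    have pV: "p \<in> verts G" "p \<noteq> x" and qV: "q \<in> verts G" "q \<noteq> x" "q \<notin> P"
      using pq PQ by blast+
    have "\<not> connected_graph (delete_verts G S)"
    proof (rule not_connected_if_closed[of p P _ q])
      fix a b
      assume a: "a \<in> P" and "{a, b} \<in> edges (delete_verts G S)"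
      then have ab: "{a, b} \<in> edges G" "{a, b} \<inter> S = {}" by (auto simp: delete_verts_def)
      then have "{a, b} \<notin> K" using c unfolding S_def by blast
      moreover have "b \<in> P \<union> Q"
        using ab simple_edge_ends(3)[OF assms(1) ab(1)] PQ(1) by (auto simp: S_def)
      ultimately show "b \<in> P" using a ab(1) by (auto simp: K_def)
    qed (use pq pV qV c in \<open>auto simp: S_def delete_verts_def\<close>)
    moreover have "S \<subseteq> verts G"
    proof -
      have "f \<subseteq> verts G" if "f \<in> K" for f
        using that simple_edge_subset[OF assms(1)] by (simp add: K_def)
      then show ?thesis using c assms(2) unfolding S_def by blast
    qed
    moreover have "p \<notin> S" using pV c by (auto simp: S_def)
    ultimately have "vertex_cut G S" using pV by (auto simp: vertex_cut_def)
    moreover have "\<not> complete_graph G"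
      using pq pV qV unfolding complete_graph_def by metis
    ultimately have "vertex_connectivity G \<le> card S" by (rule vertex_connectivity_le_card)
    also have "\<dots> \<le> card (c ` K) + 1" by (simp add: S_def finK card_insert_if)
    also have "\<dots> \<le> card K + 1" by (simp add: card_image_le finK)
    finally show ?thesis by (simp add: K_def)
  qed
qed

section \<open>Boundaries in a replacement product\<close>

locale replacement =
  fixes G\<^sub>1 :: "'a ugraph" and G\<^sub>2 :: "'b ugraph" and e :: "'a \<Rightarrow> 'b \<Rightarrow> 'a set"
  assumes simple1: "simple_graph G\<^sub>1" and simple2: "simple_graph G\<^sub>2"
    and labelling: "edge_labelling G\<^sub>1 G\<^sub>2 e"
begin

abbreviation R :: "('a \<times> 'b) ugraph" where
  "R \<equiv> replacement_product G\<^sub>1 G\<^sub>2 e"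

text \<open>
  The edge of the product that comes from the edge \<open>f\<close> of the first factor, described without a
  choice of an orientation of \<open>f\<close>.
\<close>

definition cross :: "'a set \<Rightarrow> ('a \<times> 'b) set" where
  "cross f = {(x, i). x \<in> f \<and> i \<in> verts G\<^sub>2 \<and> e x i = f}"

definition crossing :: "('a \<times> 'b) set \<Rightarrow> 'a set set" where
  "crossing X = {f \<in> edges G\<^sub>1. cross f \<inter> X \<noteq> {} \<and> \<not> cross f \<subseteq> X}"

abbreviation slice :: "('a \<times> 'b) set \<Rightarrow> 'a \<Rightarrow> 'b set" where
  "slice X x \<equiv> Pair x -` X"

lemma verts_R: "verts R = verts G\<^sub>1 \<times> verts G\<^sub>2"
  by (simp add: replacement_product_def)

lemma label_edge:
  assumes "x \<in> verts G\<^sub>1" "i \<in> verts G\<^sub>2"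
  shows "e x i \<in> edges G\<^sub>1" "x \<in> e x i"
  using assms labelling unfolding edge_labelling_def bij_betw_def incident_edges_def by blast+

lemma label_inj: "x \<in> verts G\<^sub>1 \<Longrightarrow> inj_on (e x) (verts G\<^sub>2)"
  using labelling unfolding edge_labelling_def bij_betw_def by blast

lemma label_ex:
  assumes "x \<in> verts G\<^sub>1" "f \<in> edges G\<^sub>1" "x \<in> f"
  obtains i where "i \<in> verts G\<^sub>2" "e x i = f"
proof -
  have "f \<in> e x ` verts G\<^sub>2"
    using assms labelling unfolding edge_labelling_def bij_betw_def incident_edges_def by blast
  then show ?thesis using that by blast
qed

lemma cross_eq:
  assumes "x \<in> verts G\<^sub>1" "y \<in> verts G\<^sub>1" "i \<in> verts G\<^sub>2" "j \<in> verts G\<^sub>2"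
    "e x i = {x, y}" "e y j = {x, y}"
  shows "cross {x, y} = {(x, i), (y, j)}"
proof -
  have i: "k = i" if "k \<in> verts G\<^sub>2" "e x k = {x, y}" for k
    by (rule inj_onD[OF label_inj[OF assms(1)] _ that(1) assms(3)])
      (simp only: that(2) assms(5))
  have j: "k = j" if "k \<in> verts G\<^sub>2" "e y k = {x, y}" for k
    by (rule inj_onD[OF label_inj[OF assms(2)] _ that(1) assms(4)])
      (simp only: that(2) assms(6))
  show ?thesis
  proof
    show "cross {x, y} \<subseteq> {(x, i), (y, j)}"
      using i j unfolding cross_def by blast
    show "{(x, i), (y, j)} \<subseteq> cross {x, y}"
      using assms unfolding cross_def by blast
  qed
qed

lemma crossE:
  assumes "f \<in> edges G\<^sub>1"
  obtains x i y j where "x \<in> verts G\<^sub>1" "y \<in> verts G\<^sub>1" "x \<noteq> y" "f = {x, y}"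
    "i \<in> verts G\<^sub>2" "j \<in> verts G\<^sub>2" "e x i = f" "e y j = f" "cross f = {(x, i), (y, j)}"
proof -
  obtain x y where xy: "x \<in> verts G\<^sub>1" "y \<in> verts G\<^sub>1" "x \<noteq> y" "f = {x, y}"
    using simple1 assms by (rule simple_edgeE)
  have "x \<in> f" "y \<in> f" using xy(4) by auto
  obtain i where i: "i \<in> verts G\<^sub>2" "e x i = f"
    by (rule label_ex[OF xy(1) assms \<open>x \<in> f\<close>])
  obtain j where j: "j \<in> verts G\<^sub>2" "e y j = f"
    by (rule label_ex[OF xy(2) assms \<open>y \<in> f\<close>])
  have "cross f = {(x, i), (y, j)}"
    unfolding xy(4) using i(2) j(2) xy(4) by (intro cross_eq xy(1,2) i(1) j(1)) auto
  then show ?thesis by (rule that[OF xy i(1) j(1) i(2) j(2)])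
qed

lemma fst_cross:
  assumes "f \<in> edges G\<^sub>1"
  shows "fst ` cross f = f"
proof -
  obtain x i y j where f: "f = {x, y}" and cross: "cross f = {(x, i), (y, j)}"
    using assms by (rule crossE)
  show ?thesis unfolding cross by (simp add: f)
qed

text \<open>
  The adjacency of the product in a form in which the two kinds of edges can be counted separately.
\<close>

lemma edges_R: "edges R = (\<Union>x \<in> verts G\<^sub>1. (`) (Pair x) ` edges G\<^sub>2) \<union> cross ` edges G\<^sub>1"
  (is "_ = ?I \<union> ?C")
proof (intro set_eqI iffI)
  fix g assume "g \<in> edges R"
  then obtain x i y j where g: "g = {(x, i), (y, j)}"
    and V: "x \<in> verts G\<^sub>1" "i \<in> verts G\<^sub>2" "y \<in> verts G\<^sub>1" "j \<in> verts G\<^sub>2"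
    and cases: "x = y \<and> {i, j} \<in> edges G\<^sub>2 \<or>
         {x, y} \<in> edges G\<^sub>1 \<and> e x i = {x, y} \<and> e y j = {x, y}"
    unfolding replacement_product_def by auto
  from cases show "g \<in> ?I \<union> ?C"
  proof (elim disjE conjE)
    assume "x = y" "{i, j} \<in> edges G\<^sub>2"
    then have "g = Pair x ` {i, j}" using g by simp
    then show ?thesis using V \<open>{i, j} \<in> edges G\<^sub>2\<close> by blast
  next
    assume xy: "{x, y} \<in> edges G\<^sub>1" "e x i = {x, y}" "e y j = {x, y}"
    then have "g = cross {x, y}"
      using V g cross_eq by simp
    then show ?thesis using xy by blast
  qed
next
  fix g assume "g \<in> ?I \<union> ?C"
  then show "g \<in> edges R"
  proof
    assume "g \<in> ?I"
    then obtain x f where x: "x \<in> verts G\<^sub>1" "f \<in> edges G\<^sub>2" "g = Pair x ` f" by blast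
    obtain i j where "i \<in> verts G\<^sub>2" "j \<in> verts G\<^sub>2" "i \<noteq> j" "f = {i, j}"
      using simple2 x(2) by (rule simple_edgeE)
    then show ?thesis using x unfolding replacement_product_def by auto
  next
    assume "g \<in> ?C"
    then obtain f where f: "f \<in> edges G\<^sub>1" "g = cross f" by blast
    from f(1) show ?thesis
    proof (rule crossE)
      fix x i y j
      assume "x \<in> verts G\<^sub>1" "y \<in> verts G\<^sub>1" "x \<noteq> y" "f = {x, y}" "i \<in> verts G\<^sub>2" "j \<in> verts G\<^sub>2"
        "e x i = f" "e y j = f" "cross f = {(x, i), (y, j)}"
      then show ?thesis using f unfolding replacement_product_def by auto
    qed
  qed
qed

lemma fibre_edge_R:
  assumes "x \<in> verts G\<^sub>1" "{i, j} \<in> edges G\<^sub>2"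
  shows "{(x, i), (x, j)} \<in> edges R"
proof -
  have "{(x, i), (x, j)} = Pair x ` {i, j}" by simp
  then show ?thesis using assms unfolding edges_R by blast
qed

lemma fibre_edge_iff_R:
  "{(x, i), (x, j)} \<in> edges R \<longleftrightarrow> x \<in> verts G\<^sub>1 \<and> {i, j} \<in> edges G\<^sub>2"
proof
  assume "{(x, i), (x, j)} \<in> edges R"
  moreover have "{x} \<notin> edges G\<^sub>1" using simple_edge_ends(1)[OF simple1, of x x] by auto
  ultimately show "x \<in> verts G\<^sub>1 \<and> {i, j} \<in> edges G\<^sub>2"
    unfolding replacement_product_def by (auto simp: doubleton_eq_iff insert_commute)
qed (simp add: fibre_edge_R)

lemma cross_neighbour_R:
  assumes "x \<in> verts G\<^sub>1" "i \<in> verts G\<^sub>2"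
  obtains y j where "y \<noteq> x" "y \<in> verts G\<^sub>1" "{(x, i), (y, j)} \<in> edges R" "(y, j) \<in> cross (e x i)"
proof -
  have f: "e x i \<in> edges G\<^sub>1" and xi: "(x, i) \<in> cross (e x i)"
    using label_edge[OF assms] assms by (auto simp: cross_def)
  from f show ?thesis
  proof (rule crossE)
    fix y j z k
    assume *: "y \<in> verts G\<^sub>1" "z \<in> verts G\<^sub>1" "y \<noteq> z" "cross (e x i) = {(y, j), (z, k)}"
    have "{(y, j), (z, k)} \<in> edges R" using * f unfolding edges_R by blast
    then show ?thesis
      using xi * that[of z k] that[of y j] by (auto simp: insert_commute)
  qed
qed

lemma simple_R: "simple_graph R"
proof -
  have "finite (verts R)"
    using simple1 simple2 by (simp add: verts_R simple_graph_def)
  moreover have "\<exists>u \<in> verts R. \<exists>v \<in> verts R. u \<noteq> v \<and> g = {u, v}" if "g \<in> edges R" for g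
    using that unfolding replacement_product_def by auto
  ultimately show ?thesis unfolding simple_graph_def by blast
qed

text \<open>
  The two kinds of edges are told apart by their projections to the first factor, which are a single
  vertex \<open>x\<close> for the edges in the fibre over \<open>x\<close> and the edge \<open>f\<close> itself for the cross edge of \<open>f\<close>.
  So the union below is disjoint, and distinct edges of \<open>G\<^sub>1\<close> have distinct cross edges.
\<close>

lemma card_boundary_R:
  "card (boundary R X) =
     (\<Sum>x \<in> verts G\<^sub>1. card (boundary G\<^sub>2 (slice X x))) + card (crossing X)"
proof -
  let ?I = "\<lambda>x. (`) (Pair x) ` boundary G\<^sub>2 (slice X x)"
  have cut_iff: "Pair x ` f \<inter> X \<noteq> {} \<and> \<not> Pair x ` f \<subseteq> X \<longleftrightarrow>
      f \<inter> slice X x \<noteq> {} \<and> \<not> f \<subseteq> slice X x" for x f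
    by blast
  have I: "?I x = {g \<in> (`) (Pair x) ` edges G\<^sub>2. g \<inter> X \<noteq> {} \<and> \<not> g \<subseteq> X}" for x
    unfolding boundary_def cut_iff[symmetric] by blast
  have C: "cross ` crossing X = {g \<in> cross ` edges G\<^sub>1. g \<inter> X \<noteq> {} \<and> \<not> g \<subseteq> X}"
    unfolding crossing_def by blast
  have split: "boundary R X = (\<Union>x \<in> verts G\<^sub>1. ?I x) \<union> cross ` crossing X"
    unfolding I C unfolding boundary_def edges_R by blast
  have finI: "finite (?I x)" for x
    by (intro finite_imageI finite_boundary simple2)
  have finV: "finite (verts G\<^sub>1)" using simple1 by (simp add: simple_graph_def)
  have finC: "finite (crossing X)"
    using finite_edges[OF simple1] by (simp add: crossing_def)
  have fstI: "fst ` g = {x}" if g: "g \<in> ?I x" for g x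
  proof -
    obtain f where f: "g = Pair x ` f" "f \<in> boundary G\<^sub>2 (slice X x)" by (rule imageE[OF g])
    have "f \<noteq> {}" using f(2) unfolding boundary_def by blast
    then show ?thesis unfolding f(1) image_image by (simp add: image_constant_conv)
  qed
  have fstC: "fst ` g \<noteq> {z}" if g: "g \<in> cross ` crossing X" for g z
  proof -
    obtain f where f: "f \<in> edges G\<^sub>1" "g = cross f" using g unfolding crossing_def by blast
    obtain x y where "x \<noteq> y" "f = {x, y}" by (rule simple_edgeE[OF simple1 f(1)])
    then have "f \<noteq> {z}" by auto
    then show ?thesis unfolding f(2) fst_cross[OF f(1)] .
  qed
  have "g \<notin> cross ` crossing X" if "g \<in> ?I x" for g x
    using fstI[OF that] fstC[of g x] by blast
  then have "(\<Union>x \<in> verts G\<^sub>1. ?I x) \<inter> cross ` crossing X = {}" by blast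
  then have total: "card (boundary R X) = card (\<Union>x \<in> verts G\<^sub>1. ?I x) + card (cross ` crossing X)"
    unfolding split by (intro card_Un_disjoint finite_UN_I finV finI finite_imageI finC)
  have union: "card (\<Union>x \<in> verts G\<^sub>1. ?I x) = (\<Sum>x \<in> verts G\<^sub>1. card (?I x))"
  proof (intro card_UN_disjoint finV ballI impI finI)
    fix x y :: 'a assume "x \<noteq> y"
    have "x = y" if g: "g \<in> ?I x" "g \<in> ?I y" for g
      using fstI[OF g(1)] fstI[OF g(2)] by simp
    with \<open>x \<noteq> y\<close> show "?I x \<inter> ?I y = {}" by blast
  qed
  have fibre: "card (?I x) = card (boundary G\<^sub>2 (slice X x))" for x
  proof (rule card_image)
    have "inj (Pair x :: 'b \<Rightarrow> 'a \<times> 'b)" by (rule injI) simp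
    then show "inj_on ((`) (Pair x)) (boundary G\<^sub>2 (slice X x))"
      by (intro inj_onI) (simp only: inj_image_eq_iff)
  qed
  have cross: "card (cross ` crossing X) = card (crossing X)"
  proof (intro card_image inj_onI)
    fix f g assume fg: "f \<in> crossing X" "g \<in> crossing X" "cross f = cross g"
    then have "f \<in> edges G\<^sub>1" "g \<in> edges G\<^sub>1" unfolding crossing_def by blast+
    then have "f = fst ` cross f" "fst ` cross g = g" by (simp_all only: fst_cross)
    then show "f = g" using fg(3) by (simp only:)
  qed
  show ?thesis unfolding total union fibre cross ..
qed

lemma card_fibre_boundaries_le:
  assumes "Y \<subseteq> verts G\<^sub>1"
  shows "(\<Sum>x \<in> Y. card (boundary G\<^sub>2 (slice X x))) + card (crossing X) \<le> card (boundary R X)"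
proof -
  have "finite (verts G\<^sub>1)" using simple1 by (simp add: simple_graph_def)
  then show ?thesis unfolding card_boundary_R using assms by (simp add: sum_mono2)
qed

end

section \<open>Upper bounds\<close>

locale connected_replacement = replacement +
  assumes nonempty1: "verts G\<^sub>1 \<noteq> {}" and connected2: "connected_graph G\<^sub>2"
    and order2: "2 \<le> card (verts G\<^sub>2)"
begin

lemma neighbour2:
  assumes "i \<in> verts G\<^sub>2"
  obtains j where "{i, j} \<in> edges G\<^sub>2"
proof (rule ccontr)
  assume no: "\<not> thesis"
  have "verts G\<^sub>2 \<noteq> {i}" using order2 by auto
  then obtain k where k: "k \<in> verts G\<^sub>2" "k \<noteq> i" using assms by blast
  have "\<not> connected_graph G\<^sub>2"
    using no that k assms by (intro not_connected_if_closed[of i "{i}" _ k]) auto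
  then show False using connected2 by blast
qed

lemma nonempty2: "verts G\<^sub>2 \<noteq> {}"
  using order2 by auto

lemma two_vertices1:
  obtains x y where "x \<in> verts G\<^sub>1" "y \<in> verts G\<^sub>1" "x \<noteq> y"
  using nonempty1 nonempty2 cross_neighbour_R by (metis ex_in_conv)

text \<open>
  The cross edge of \<open>f\<close> has an end in the fibre over each end of \<open>f\<close>, whatever the labels are.
\<close>

lemma mem_crossingI:
  assumes "f \<in> edges G\<^sub>1" "x \<in> f" "y \<in> f" "x \<in> verts G\<^sub>1" "y \<in> verts G\<^sub>1"
    and "verts G\<^sub>2 \<subseteq> slice X x" "slice X y = {}"
  shows "f \<in> crossing X"
proof -
  obtain i j where "i \<in> verts G\<^sub>2" "e x i = f" "j \<in> verts G\<^sub>2" "e y j = f"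
    using label_ex assms(1-5) by metis
  then have "(x, i) \<in> cross f \<inter> X" "(y, j) \<in> cross f - X"
    using assms by (auto simp: cross_def)
  then show ?thesis using assms(1) unfolding crossing_def by blast
qed

text \<open>
  The cross edges of an edge cut of \<open>G\<^sub>1\<close> disconnect the product, and every vertex keeps its
  neighbours in its own fibre.
\<close>

lemma restricted_edge_cut_of_edge_cut1:
  obtains F where "restricted_edge_cut R F" "card F = edge_connectivity G\<^sub>1"
proof -
  obtain x y where "x \<in> verts G\<^sub>1" "y \<in> verts G\<^sub>1" "x \<noteq> y" by (rule two_vertices1)
  then obtain P where P: "P \<noteq> {}" "P \<subset> verts G\<^sub>1"
    "card (boundary G\<^sub>1 P) = edge_connectivity G\<^sub>1"
    using edge_connectivity_attained[OF simple1] by metis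
  let ?X = "P \<times> verts G\<^sub>2"
  have "\<exists>w. {v, w} \<in> edges R \<and> (w \<in> ?X \<longleftrightarrow> v \<in> ?X)" if v: "v \<in> verts R" for v
  proof -
    obtain x i where xi: "v = (x, i)" "x \<in> verts G\<^sub>1" "i \<in> verts G\<^sub>2"
      using v by (auto simp: verts_R)
    obtain j where "{i, j} \<in> edges G\<^sub>2" using neighbour2[OF xi(3)] .
    then show ?thesis
      using xi fibre_edge_R simple_edge_ends(3)[OF simple2] by (intro exI[of _ "(x, j)"]) auto
  qed
  moreover have "?X \<noteq> {}" "?X \<subset> verts R"
    using P nonempty2 by (auto simp: verts_R)
  ultimately have side: "restricted_side R ?X"
    unfolding restricted_side_def by blast
  have "boundary G\<^sub>2 (slice ?X x) = {}" for x
  proof -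
    have "f \<subseteq> verts G\<^sub>2" if "f \<in> edges G\<^sub>2" for f
      using simple_edge_subset[OF simple2 that] .
    then show ?thesis by (auto simp: boundary_def)
  qed
  moreover have "crossing ?X = boundary G\<^sub>1 P"
  proof
    show "crossing ?X \<subseteq> boundary G\<^sub>1 P"
      by (auto simp: crossing_def boundary_def cross_def)
    show "boundary G\<^sub>1 P \<subseteq> crossing ?X"
    proof
      fix f assume "f \<in> boundary G\<^sub>1 P"
      then obtain x y where f: "f \<in> edges G\<^sub>1" "x \<in> f" "x \<in> P" "y \<in> f" "y \<notin> P"
        unfolding boundary_def by blast
      have "f \<subseteq> verts G\<^sub>1" using simple_edge_subset[OF simple1 f(1)] .
      then show "f \<in> crossing ?X" using f by (intro mem_crossingI[of f x y]) auto
    qed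
  qed
  ultimately have "card (boundary R ?X) = edge_connectivity G\<^sub>1"
    using P(3) by (simp add: card_boundary_R)
  with restricted_edge_cut_boundary[OF simple_R side] show ?thesis by (rule that)
qed

text \<open>
  The edge \<open>ij\<close> in one fibre is separated from the rest by two cross edges and by at most
  \<open>d(i) + d(j) - 2\<close> edges of the fibre. No vertex is isolated: the other vertices of that fibre keep
  their cross edge, which leads into another fibre, and the remaining vertices keep their neighbours
  in their own fibre.
\<close>

lemma restricted_edge_connectivity_le_fibre_edge:
  assumes ij: "{i, j} \<in> edges G\<^sub>2"
  shows "restricted_edge_connectivity R \<le> degree G\<^sub>2 i + degree G\<^sub>2 j"
proof -
  obtain x where x: "x \<in> verts G\<^sub>1" using nonempty1 by blast
  note ij_verts = simple_edge_ends[OF simple2 ij]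
  let ?X = "{x} \<times> {i, j}"
  have ex: "\<exists>w. {v, w} \<in> edges R \<and> (w \<in> ?X \<longleftrightarrow> v \<in> ?X)" if v: "v \<in> verts R" for v
  proof -
    obtain y k where yk: "v = (y, k)" "y \<in> verts G\<^sub>1" "k \<in> verts G\<^sub>2"
      using v by (auto simp: verts_R)
    consider "v \<in> ?X" | "y \<noteq> x" | "y = x" "v \<notin> ?X" by blast
    then show ?thesis
    proof cases
      case 1
      then have "v = (x, i) \<or> v = (x, j)" by auto
      moreover have "{(x, i), (x, j)} \<in> edges R" "{(x, j), (x, i)} \<in> edges R"
        using fibre_edge_R[OF x ij] by (simp_all add: insert_commute)
      moreover have "(x, i) \<in> ?X" "(x, j) \<in> ?X" by auto
      ultimately show ?thesis by blast
    next
      case 2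
      obtain l where "{k, l} \<in> edges G\<^sub>2" using neighbour2[OF yk(3)] .
      then show ?thesis using 2 yk fibre_edge_R by (intro exI[of _ "(y, l)"]) auto
    next
      case 3
      obtain z l where "z \<noteq> y" "{(y, k), (z, l)} \<in> edges R"
        using cross_neighbour_R[OF yk(2,3)] by metis
      then show ?thesis using 3 yk by (intro exI[of _ "(z, l)"]) auto
    qed
  qed
  obtain y where y: "y \<in> verts G\<^sub>1" "y \<noteq> x" using two_vertices1 by metis
  have "(y, i) \<in> verts R - ?X" using y ij_verts by (simp add: verts_R)
  then have "restricted_side R ?X"
    using ex x ij_verts unfolding restricted_side_def by (auto simp: verts_R)
  then have "restricted_edge_connectivity R \<le> card (boundary R ?X)"
    by (intro restricted_edge_connectivity_le_card restricted_edge_cut_boundary simple_R)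
  also have "\<dots> = card (boundary G\<^sub>2 {i, j}) + card (crossing ?X)"
  proof -
    have "card (boundary G\<^sub>2 (slice ?X z)) = (if z = x then card (boundary G\<^sub>2 {i, j}) else 0)" for z
    proof (cases "z = x")
      case True
      then have "slice ?X z = {i, j}" by auto
      then show ?thesis using True by simp
    next
      case False
      then have "slice ?X z = {}" by auto
      then show ?thesis using False by (simp add: boundary_def)
    qed
    then show ?thesis
      unfolding card_boundary_R using x simple1 by (simp add: simple_graph_def)
  qed
  also have "card (crossing ?X) \<le> 2"
  proof -
    have "crossing ?X \<subseteq> {e x i, e x j}" by (auto simp: crossing_def cross_def)
    then have "card (crossing ?X) \<le> card {e x i, e x j}" by (intro card_mono) auto
    also have "\<dots> \<le> 2" by (simp add: card_insert_if)
    finally show ?thesis .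
  qed
  also have "card (boundary G\<^sub>2 {i, j}) + 2 \<le> degree G\<^sub>2 i + degree G\<^sub>2 j"
  proof -
    let ?D = "\<lambda>k. incident_edges G\<^sub>2 k - {{i, j}}"
    have fin: "finite (incident_edges G\<^sub>2 k)" for k
      using finite_edges[OF simple2] by (simp add: incident_edges_def)
    have mem: "{i, j} \<in> incident_edges G\<^sub>2 i" "{i, j} \<in> incident_edges G\<^sub>2 j"
      using ij by (auto simp: incident_edges_def)
    have "boundary G\<^sub>2 {i, j} \<subseteq> ?D i \<union> ?D j"
      by (auto simp: boundary_def incident_edges_def)
    then have "card (boundary G\<^sub>2 {i, j}) \<le> card (?D i \<union> ?D j)"
      using fin by (intro card_mono) auto
    also have "\<dots> \<le> card (?D i) + card (?D j)" by (rule card_Un_le)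
    finally show ?thesis
      using card_Suc_Diff1[OF fin mem(1)] card_Suc_Diff1[OF fin mem(2)]
      unfolding degree_def by linarith
  qed
  finally show ?thesis by simp
qed

section \<open>The lower bound\<close>

lemma edge_connectivity2_le_boundary:
  assumes "x \<in> verts G\<^sub>1" "X \<subseteq> verts R" "slice X x \<noteq> {}" "slice X x \<noteq> verts G\<^sub>2"
  shows "edge_connectivity G\<^sub>2 \<le> card (boundary G\<^sub>2 (slice X x))"
  using assms by (intro edge_connectivity_le_boundary) (auto simp: verts_R)

text \<open>
  All \<open>|B|\<close> cross edges at \<open>{x} \<times> B\<close> leave the fibre. Every vertex in \<open>B\<close> has a neighbour in \<open>B\<close>,
  so \<open>|B| \<ge> 2\<close>; if the same holds for the complement of \<open>B\<close> in \<open>G\<^sub>2\<close>, the boundary of \<open>B\<close> is a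
  restricted edge-cut of \<open>G\<^sub>2\<close>. Otherwise all neighbours of some vertex \<open>a\<close> outside \<open>B\<close> lie in \<open>B\<close>,
  so that \<open>|B| \<ge> d(a) \<ge> \<lambda>\<^sub>2\<close>, and the boundary of \<open>B\<close> in \<open>G\<^sub>2\<close> contributes another \<open>\<lambda>\<^sub>2\<close>.
\<close>

lemma card_boundary_within_fibre:
  assumes x: "x \<in> verts G\<^sub>1" and B: "B \<subset> verts G\<^sub>2" and side: "restricted_side R ({x} \<times> B)"
  shows "2 * edge_connectivity G\<^sub>2 \<le> card (boundary R ({x} \<times> B)) \<or>
    restricted_edge_connectivity G\<^sub>2 + 2 \<le> card (boundary R ({x} \<times> B))"
proof -
  let ?X = "{x} \<times> B"
  have finB: "finite B"
    using simple2 B finite_subset unfolding simple_graph_def by blast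
  have B_ne: "B \<noteq> {}" using side by (auto simp: restricted_side_def)
  have B_nb: "\<exists>j \<in> B. {i, j} \<in> edges G\<^sub>2" if i: "i \<in> B" for i
  proof -
    have "(x, i) \<in> verts R" using x i B by (auto simp: verts_R)
    moreover have "(x, i) \<in> ?X" using i by simp
    ultimately obtain w where w: "{(x, i), w} \<in> edges R" "w \<in> ?X"
      using side unfolding restricted_side_def by blast
    then obtain j where "w = (x, j)" "j \<in> B" by auto
    then show ?thesis using w(1) fibre_edge_iff_R by auto
  qed
  have "card B \<le> card (crossing ?X)"
  proof -
    have "e x i \<in> crossing ?X" if i: "i \<in> B" for i
    proof -
      have iV: "i \<in> verts G\<^sub>2" using i B by blast
      obtain y j where "y \<noteq> x" "(y, j) \<in> cross (e x i)"
        using cross_neighbour_R[OF x iV] by metis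
      moreover have "(x, i) \<in> cross (e x i)"
        using label_edge[OF x iV] iV by (simp add: cross_def)
      ultimately show ?thesis using label_edge[OF x iV] i by (auto simp: crossing_def)
    qed
    then show ?thesis
      using label_inj[OF x] B finite_edges[OF simple1]
      by (intro card_inj_on_le[of "e x"]) (auto simp: crossing_def intro: inj_on_subset)
  qed
  moreover have "slice ?X x = B" by auto
  ultimately have bound: "card (boundary G\<^sub>2 B) + card B \<le> card (boundary R ?X)"
    using card_fibre_boundaries_le[of "{x}" ?X] x by simp
  show ?thesis
  proof (cases "\<forall>a \<in> verts G\<^sub>2 - B. \<exists>w. {a, w} \<in> edges G\<^sub>2 \<and> w \<notin> B")
    case True
    have "restricted_side G\<^sub>2 B"
      unfolding restricted_side_def using True B B_ne B_nb by (metis DiffI)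
    then have cut: "restricted_edge_cut G\<^sub>2 (boundary G\<^sub>2 B)"
      by (rule restricted_edge_cut_boundary[OF simple2])
    obtain i where i: "i \<in> B" using B_ne by blast
    then obtain j where "j \<in> B" "{i, j} \<in> edges G\<^sub>2" using B_nb by blast
    then have "{i, j} \<subseteq> B" "i \<noteq> j" using i simple_edge_ends(1)[OF simple2] by auto
    then have "2 \<le> card B" using card_mono[OF finB, of "{i, j}"] by simp
    then show ?thesis
      using cut restricted_edge_connectivity_le_card[OF cut] bound by auto
  next
    case False
    then obtain a where a: "a \<in> verts G\<^sub>2" "a \<notin> B" "\<And>w. {a, w} \<in> edges G\<^sub>2 \<Longrightarrow> w \<in> B" by blast
    have "degree G\<^sub>2 a \<le> card B"
    proof -
      have "incident_edges G\<^sub>2 a \<subseteq> (\<lambda>w. {a, w}) ` B"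
      proof
        fix f assume f: "f \<in> incident_edges G\<^sub>2 a"
        then have "f \<in> edges G\<^sub>2" by (simp add: incident_edges_def)
        then obtain p q where "f = {p, q}" by (rule simple_edgeE[OF simple2])
        with f have "\<exists>w. f = {a, w}" by (auto simp: incident_edges_def)
        with f a(3) show "f \<in> (\<lambda>w. {a, w}) ` B" by (auto simp: incident_edges_def)
      qed
      then show ?thesis unfolding degree_def using finB by (meson surj_card_le)
    qed
    moreover obtain i where "i \<in> B" using B_ne by blast
    then have "edge_connectivity G\<^sub>2 \<le> degree G\<^sub>2 a"
      using a B by (intro edge_connectivity_le_degree[OF simple2, of a i]) auto
    moreover have "edge_connectivity G\<^sub>2 \<le> card (boundary G\<^sub>2 B)"
      using B B_ne by (intro edge_connectivity_le_boundary) auto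
    ultimately show ?thesis using bound by linarith
  qed
qed

text \<open>
  The cases below are no mixed fibre, one, and at least two. The disjunction states the bound by the
  minimum of four terms; the term \<open>\<kappa>\<^sub>1 + \<lambda>\<^sub>2 - 1\<close> appears with the \<open>1\<close> moved to the other side, which
  avoids a truncated subtraction.
\<close>

lemma card_boundary_cases:
  assumes side: "restricted_side R X"
  shows "edge_connectivity G\<^sub>1 \<le> card (boundary R X) \<or>
    vertex_connectivity G\<^sub>1 + edge_connectivity G\<^sub>2 \<le> card (boundary R X) + 1 \<or>
    2 * edge_connectivity G\<^sub>2 \<le> card (boundary R X) \<or>
    restricted_edge_connectivity G\<^sub>2 + 2 \<le> card (boundary R X)"
    (is "?goal")
proof -
  have X: "X \<noteq> {}" "X \<subset> verts R" using side by (auto simp: restricted_side_def)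
  have finV: "finite (verts G\<^sub>1)" using simple1 by (simp add: simple_graph_def)
  have finC: "finite (crossing X)" using finite_edges[OF simple1] by (simp add: crossing_def)
  define M where "M = {x \<in> verts G\<^sub>1. slice X x \<noteq> {} \<and> slice X x \<noteq> verts G\<^sub>2}"
  define P where "P = {x \<in> verts G\<^sub>1. slice X x = verts G\<^sub>2}"
  define Q where "Q = {x \<in> verts G\<^sub>1. slice X x = {}}"
  have parts: "P \<union> Q = verts G\<^sub>1 - M" "P \<inter> Q = {}"
    using nonempty2 by (auto simp: M_def P_def Q_def)
  have crossing: "{f \<in> edges G\<^sub>1. f \<inter> P \<noteq> {} \<and> f \<inter> Q \<noteq> {}} \<subseteq> crossing X"
    by (auto simp: P_def Q_def intro: mem_crossingI)
  have mixed: "edge_connectivity G\<^sub>2 \<le> card (boundary G\<^sub>2 (slice X x))" if "x \<in> M" for x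
    using that X(2) by (intro edge_connectivity2_le_boundary) (auto simp: M_def)
  consider "M = {}" | x where "M = {x}" | x y where "x \<in> M" "y \<in> M" "x \<noteq> y" by blast
  then show ?goal
  proof cases
    case 1
    have "P \<noteq> {}"
      using X 1 parts by (auto simp: Q_def verts_R)
    moreover have "P \<noteq> verts G\<^sub>1"
      using X(2) by (auto simp: P_def verts_R)
    ultimately have "edge_connectivity G\<^sub>1 \<le> card (boundary G\<^sub>1 P)"
      by (intro edge_connectivity_le_boundary) (auto simp: P_def)
    also have "\<dots> \<le> card (crossing X)"
    proof (intro card_mono finC)
      have "f \<subseteq> P \<union> Q" if "f \<in> edges G\<^sub>1" for f
        using simple_edge_subset[OF simple1 that] 1 parts(1) by simp
      then show "boundary G\<^sub>1 P \<subseteq> crossing X"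
        using crossing unfolding boundary_def by blast
    qed
    finally show ?thesis using card_fibre_boundaries_le[of "{}" X] by simp
  next
    case (2 x)
    then have x: "x \<in> verts G\<^sub>1" "x \<in> M" by (auto simp: M_def)
    show ?thesis
    proof (cases "P = {} \<or> Q = {}")
      case False
      then have "vertex_connectivity G\<^sub>1 \<le>
          card {f \<in> edges G\<^sub>1. f \<inter> P \<noteq> {} \<and> f \<inter> Q \<noteq> {}} + 1"
        using 2 parts by (intro vertex_connectivity_le_crossing_edges[OF simple1 x(1)]) auto
      also have "\<dots> \<le> card (crossing X) + 1"
        using card_mono[OF finC crossing] by simp
      finally show ?thesis
        using card_fibre_boundaries_le[of "{x}" X] mixed[OF x(2)] x(1) by simp
    next
      case True
      \<comment> \<open>The single-fibre bound applies to \<open>X\<close> itself or to its complement, which has the same boundary.\<close>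
      have *: "?goal" if "restricted_side R ({x} \<times> B)" "B \<subset> verts G\<^sub>2"
        "boundary R X = boundary R ({x} \<times> B)" for B
        using card_boundary_within_fibre[OF x(1) that(2,1)] that(3) by auto
      from True show ?thesis
      proof
        assume "P = {}"
        then have "verts G\<^sub>1 - {x} \<subseteq> Q"
          using 2 parts(1) by auto
        then have "y = x" if "(y, i) \<in> X" for y i
          using that X(2) by (auto simp: Q_def verts_R)
        then have "X = {x} \<times> slice X x" by auto
        moreover have "slice X x \<subset> verts G\<^sub>2"
          using x X(2) by (auto simp: M_def verts_R)
        ultimately show ?thesis using *[of "slice X x"] side by metis
      next
        assume "Q = {}"
        then have "verts G\<^sub>1 - {x} \<subseteq> P"
          using 2 parts(1) by auto
        then have "y = x" if "(y, i) \<in> verts R - X" for y i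
          using that by (auto simp: P_def verts_R)
        then have "verts R - X = {x} \<times> (verts G\<^sub>2 - slice X x)"
          using x by (auto simp: verts_R)
        moreover have "verts G\<^sub>2 - slice X x \<subset> verts G\<^sub>2"
          using x X(2) by (auto simp: M_def verts_R)
        ultimately show ?thesis
          using *[of "verts G\<^sub>2 - slice X x"] boundary_complement[OF simple_R, of X]
            restricted_side_complement[OF simple_R side] by metis
      qed
    qed
  next
    case (3 x y)
    have "(\<Sum>z \<in> {x, y}. card (boundary G\<^sub>2 (slice X z))) \<le> card (boundary R X)"
      using card_fibre_boundaries_le[of "{x, y}" X] 3 by (auto simp: M_def)
    then show ?thesis using mixed[OF 3(1)] mixed[OF 3(2)] 3(3) by simp
  qed
qed

lemma restricted_edge_connectivity_lower_bound:
  "edge_connectivity G\<^sub>1 \<le> restricted_edge_connectivity R \<or>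
    vertex_connectivity G\<^sub>1 + edge_connectivity G\<^sub>2 \<le> restricted_edge_connectivity R + 1 \<or>
    2 * edge_connectivity G\<^sub>2 \<le> restricted_edge_connectivity R \<or>
    restricted_edge_connectivity G\<^sub>2 + 2 \<le> restricted_edge_connectivity R"
proof -
  obtain F\<^sub>0 where "restricted_edge_cut R F\<^sub>0" by (rule restricted_edge_cut_of_edge_cut1)
  then obtain F where F: "restricted_edge_cut R F" "card F = restricted_edge_connectivity R"
    by (rule restricted_edge_connectivity_attained)
  have "verts R \<noteq> {}" using nonempty1 nonempty2 by (simp add: verts_R)
  then obtain X where X: "restricted_side R X" "boundary R X \<subseteq> F"
    using restricted_edge_cut_contains_boundary[OF simple_R _ F(1)] by metis
  have "finite F"
    using F(1) finite_edges[OF simple_R] finite_subset unfolding restricted_edge_cut_def by blast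
  then have "card (boundary R X) \<le> restricted_edge_connectivity R"
    using card_mono[OF _ X(2)] F(2) by simp
  then show ?thesis using card_boundary_cases[OF X(1)] by auto
qed

end

section \<open>Optimal fibres\<close>

lemma min_edge_degree_regular:
  assumes "simple_graph G" "regular_graph d G" "edges G \<noteq> {}"
  shows "min_edge_degree G = 2 * d - 2"
proof -
  have "(\<lambda>(x, y). degree G x + degree G y - 2) ` {(x, y). {x, y} \<in> edges G} = {2 * d - 2}"
  proof (intro equalityI subsetI)
    fix k assume "k \<in> (\<lambda>(x, y). degree G x + degree G y - 2) ` {(x, y). {x, y} \<in> edges G}"
    then obtain x y where "{x, y} \<in> edges G" "k = degree G x + degree G y - 2" by auto
    then show "k \<in> {2 * d - 2}"
      using assms simple_edge_ends(2,3)[OF assms(1)] by (simp add: regular_graph_def)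
  next
    fix k assume k: "k \<in> {2 * d - 2}"
    obtain f where f: "f \<in> edges G" using assms(3) by blast
    then obtain x y where "x \<in> verts G" "y \<in> verts G" "f = {x, y}"
      by (metis simple_edgeE[OF assms(1)])
    then show "k \<in> (\<lambda>(x, y). degree G x + degree G y - 2) ` {(x, y). {x, y} \<in> edges G}"
      using f k assms(2) by (auto simp: regular_graph_def intro!: image_eqI[of _ _ "(x, y)"])
  qed
  then show ?thesis unfolding min_edge_degree_def by (simp only: cInf_singleton)
qed

lemma restricted_edge_connectivity_pos:
  assumes "simple_graph G" "connected_graph G" "restricted_edge_cut G F"
  shows "0 < restricted_edge_connectivity G"
proof -
  obtain F' where F': "restricted_edge_cut G F'" "card F' = restricted_edge_connectivity G"
    using restricted_edge_connectivity_attained[OF assms(3)] .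
  have "F' \<noteq> {}"
    using F'(1) assms(2) by (auto simp: restricted_edge_cut_def delete_edges_empty)
  moreover have "finite F'"
    using F'(1) finite_edges[OF assms(1)] finite_subset unfolding restricted_edge_cut_def by blast
  ultimately show ?thesis using F'(2) by (metis card_gt_0_iff)
qed

text \<open>
  A positive \<open>\<lambda>' = \<xi> = 2d - 2\<close> forces \<open>d \<ge> 2\<close>. A minimum edge cut either leaves no isolated vertex,
  and then it is a restricted edge-cut with at least \<open>2d - 2 \<ge> d\<close> edges, or it contains all \<open>d\<close> edges
  at some vertex.
\<close>

lemma restricted_optimal_regular:
  assumes G: "simple_graph G" "regular_graph d G" "edges G \<noteq> {}" and opt: "restricted_optimal G"
  shows "restricted_edge_connectivity G + 2 = 2 * d" "d \<le> edge_connectivity G"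
proof -
  obtain F where F: "connected_graph G" "restricted_edge_cut G F"
    using opt by (auto simp: restricted_optimal_def restricted_connected_def)
  have "restricted_edge_connectivity G = 2 * d - 2"
    using opt min_edge_degree_regular[OF G] by (simp add: restricted_optimal_def)
  moreover from this have d: "2 \<le> d"
    using restricted_edge_connectivity_pos[OF G(1) F] by linarith
  ultimately show eq: "restricted_edge_connectivity G + 2 = 2 * d" by simp
  obtain f where "f \<in> edges G" using G(3) by blast
  then obtain u v where "u \<in> verts G" "v \<in> verts G" "u \<noteq> v"
    by (metis simple_edgeE[OF G(1)])
  then obtain X where X: "X \<noteq> {}" "X \<subset> verts G" "card (boundary G X) = edge_connectivity G"
    by (rule edge_connectivity_attained[OF G(1)])
  show "d \<le> edge_connectivity G"
  proof (cases "\<forall>v \<in> verts G. degree (delete_edges G (boundary G X)) v \<noteq> 0")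
    case True
    then have "restricted_edge_cut G (boundary G X)"
      using not_connected_delete_boundary[OF X(1,2) order_refl]
      by (auto simp: restricted_edge_cut_def boundary_def)
    then have "restricted_edge_connectivity G \<le> edge_connectivity G"
      using restricted_edge_connectivity_le_card X(3) by metis
    then show ?thesis using eq d by linarith
  next
    case False
    then obtain v where v: "v \<in> verts G" "degree (delete_edges G (boundary G X)) v = 0" by blast
    then have none: "{v, w} \<notin> edges G - boundary G X" for w
      using delete_edges_degree_nonzero_iff[OF G(1)] by blast
    have "incident_edges G v \<subseteq> boundary G X"
    proof
      fix f assume f: "f \<in> incident_edges G v"
      then obtain p q where "f = {p, q}"
        by (metis (lifting) incident_edges_def mem_Collect_eq simple_edgeE[OF G(1)])
      with f none[of p] none[of q] show "f \<in> boundary G X"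
        by (auto simp: incident_edges_def insert_commute)
    qed
    then have "degree G v \<le> edge_connectivity G"
      unfolding degree_def X(3)[symmetric] by (intro card_mono finite_boundary G(1))
    then show ?thesis using G(2) v(1) by (simp add: regular_graph_def)
  qed
qed

section \<open>The restricted edge-connectivity of a replacement product\<close>

theorem theorem4p4:
  fixes G\<^sub>1 :: "'a ugraph" and G\<^sub>2 :: "'b ugraph"
    and e :: "'a \<Rightarrow> 'b \<Rightarrow> 'a set"
    and n \<delta>\<^sub>1 \<delta>\<^sub>2 :: nat
    and kappa1 lambda1 lambda2 lambda2' lambda' :: int
  assumes "simple_graph G\<^sub>1" and "connected_graph G\<^sub>1"
    and "regular_graph \<delta>\<^sub>1 G\<^sub>1" and "card (verts G\<^sub>1) = n"
    and "simple_graph G\<^sub>2" and "connected_graph G\<^sub>2"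
    and "regular_graph \<delta>\<^sub>2 G\<^sub>2" and "card (verts G\<^sub>2) = \<delta>\<^sub>1"
    and "\<delta>\<^sub>1 \<ge> 4"
    and "edge_labelling G\<^sub>1 G\<^sub>2 e"
    and "kappa1 = int (vertex_connectivity G\<^sub>1)"
    and "lambda1 = int (edge_connectivity G\<^sub>1)"
    and "lambda2 = int (edge_connectivity G\<^sub>2)"
    and "lambda2' = int (restricted_edge_connectivity G\<^sub>2)"
    and "lambda' = int (restricted_edge_connectivity (replacement_product G\<^sub>1 G\<^sub>2 e))"
  shows "Min {lambda1, kappa1 + lambda2 - 1, 2 * lambda2, lambda2' + 2} \<le> lambda' \<and>
         lambda' \<le> Min {lambda1, 2 * int \<delta>\<^sub>2} \<and>
         ((kappa1 \<ge> lambda1 - lambda2 + 1 \<or> kappa1 \<ge> lambda2 + 1) \<and> restricted_optimal G\<^sub>2 \<longrightarrow>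
            lambda' = Min {lambda1, 2 * int \<delta>\<^sub>2})"
proof -
  interpret connected_replacement G\<^sub>1 G\<^sub>2 e
    using assms by unfold_locales (auto simp: connected_graph_def)
  obtain i where i: "i \<in> verts G\<^sub>2" using nonempty2 by blast
  obtain j where ij: "{i, j} \<in> edges G\<^sub>2" using neighbour2[OF i] .
  have "degree G\<^sub>2 i + degree G\<^sub>2 j = 2 * \<delta>\<^sub>2"
    using assms(7) simple_edge_ends(2,3)[OF simple2 ij] by (simp add: regular_graph_def)
  then have "restricted_edge_connectivity R \<le> 2 * \<delta>\<^sub>2"
    using restricted_edge_connectivity_le_fibre_edge[OF ij] by simp
  moreover have "restricted_edge_connectivity R \<le> edge_connectivity G\<^sub>1"
    using restricted_edge_cut_of_edge_cut1 restricted_edge_connectivity_le_card by metis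
  ultimately have upper: "lambda' \<le> lambda1" "lambda' \<le> 2 * int \<delta>\<^sub>2"
    using assms(12,15) by auto
  have lower: "lambda1 \<le> lambda' \<or> kappa1 + lambda2 - 1 \<le> lambda' \<or> 2 * lambda2 \<le> lambda' \<or>
      lambda2' + 2 \<le> lambda'"
    using restricted_edge_connectivity_lower_bound unfolding assms(11-15) by linarith
  have "lambda' = Min {lambda1, 2 * int \<delta>\<^sub>2}"
    if kappa: "kappa1 \<ge> lambda1 - lambda2 + 1 \<or> kappa1 \<ge> lambda2 + 1"
      and opt: "restricted_optimal G\<^sub>2"
  proof -
    have "edges G\<^sub>2 \<noteq> {}" using ij by blast
    then have "lambda2' + 2 = 2 * int \<delta>\<^sub>2" "int \<delta>\<^sub>2 \<le> lambda2"
      using restricted_optimal_regular[OF simple2 assms(7) _ opt] assms(13,14) by auto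
    then show ?thesis using lower upper kappa by (auto simp: min_def)
  qed
  with lower upper show ?thesis by (auto simp: min_le_iff_disj)
qed

end
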